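(* Suppose there exists a balanced POTB with $f$ factors on $b$ blocks of size $k$ each, with $f\le k$. If further an orthogonal array $OA(k^2,m+1,k,2)$ exists, then there also exists a balanced POTB with $mf$ factors on $bk$ blocks of size $k$ each.
   Context: $OA(n,r,k,2)$ denotes an orthogonal array of strength $2$ with $r$ rows, $n$ columns and $k$ symbols: an $r\times n$ array over a $k$-set of symbols such that in any two distinct rows every ordered pair of symbols occurs equally often as a column. Let $b,k,t\ge 1$ be integers. A blocked main effect plan (MEP) with $t$ factors $F_1,\dots,F_t$ on $b$ blocks of size $k$ each is a $(t+1)\times bk$ array, with rows indexed $0,1,\dots,t$. The entries of row $0$ (the block factor $B$) lie in $\{1,\dots,b\}$ and each $j\in\{1,\dots,b\}$ appears exactly $k$ times in row $0$. For $1\le i\le t$ the entries of row $i$ lie in a set $S_i$ of size $s_i$, and $F_i$ is said to have $s_i$ levels (the elements of $S_i$). Each column is a run (plot); columns with entry $j$ in row $0$ form the $j$th block. Columns may be repeated. For $1\le i,j\le t$, $M_{ij}$ is the $s_i\times s_j$ matrix whose $(p,q)$ entry is the number of columns whose $i$th entry is $p$ and $j$th entry is $q$ ($p\in S_i,q\in S_j$). $M_{iB}$ is the $s_i\times b$ matrix whose $(p,j)$ entry is the number of columns whose $i$th entry is $p$ and whose row-$0$ entry is $j$. Factors $F_i,F_j$ ($i\ne j$) are orthogonal through the block factor if $M_{iB}(M_{jB})'=k\,M_{ij}$ (prime denotes transpose). A POTB (plan orthogonal through the block factor) is a blocked MEP in which every pair of distinct factors is orthogonal through the block factor. A blocked MEP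 is connected if, for each $i$, $M_{iB}$ is the incidence matrix of a connected block design, i.e. the graph on $S_i$ in which two levels are adjacent when some block contains both is connected. A connected POTB is balanced if for each $i$, $M_{iB}$ is the treatment-versus-block incidence matrix of a balanced incomplete block design (BIBD); here the number of levels may differ from factor to factor. *)

theory Defs
  imports Main
begin

text \<open>
  An array with rows \<open>{1..r}\<close> and columns \<open>{1..n}\<close> is a function of the row index and the column
  index; only its values at these indices matter.
\<close>

definition orthogonal_array2 :: "nat \<Rightarrow> nat \<Rightarrow> nat \<Rightarrow> 'c set \<Rightarrow> (nat \<Rightarrow> nat \<Rightarrow> 'c) \<Rightarrow> bool" where
  "orthogonal_array2 n r k \<Sigma> A \<longleftrightarrow>
     finite \<Sigma> \<and> card \<Sigma> = k \<and>
     (\<forall>i\<in>{1..r}. \<forall>c\<in>{1..n}. A i c \<in> \<Sigma>) \<and>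
     (\<forall>i\<in>{1..r}. \<forall>j\<in>{1..r}. i \<noteq> j \<longrightarrow>
        (\<exists>l. \<forall>x\<in>\<Sigma>. \<forall>y\<in>\<Sigma>. card {c \<in> {1..n}. A i c = x \<and> A j c = y} = l))"

text \<open>
  Row 0 of a blocked main effect plan has a type of its own and is kept as a separate function
  \<open>B\<close>; the rows \<open>1, \<dots>, t\<close> are \<open>F 1, \<dots>, F t\<close>, with level sets \<open>S 1, \<dots>, S t\<close>.
\<close>

definition blocked_mep ::
  "nat \<Rightarrow> nat \<Rightarrow> nat \<Rightarrow> (nat \<Rightarrow> 'a set) \<Rightarrow> (nat \<Rightarrow> nat) \<Rightarrow> (nat \<Rightarrow> nat \<Rightarrow> 'a) \<Rightarrow> bool" where
  "blocked_mep b k t S B F \<longleftrightarrow>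
     b \<ge> 1 \<and> k \<ge> 1 \<and> t \<ge> 1 \<and>
     (\<forall>c\<in>{1..b * k}. B c \<in> {1..b}) \<and>
     (\<forall>j\<in>{1..b}. card {c \<in> {1..b * k}. B c = j} = k) \<and>
     (\<forall>i\<in>{1..t}. finite (S i) \<and> (\<forall>c\<in>{1..b * k}. F i c \<in> S i))"

text \<open>
  The matrices $M_{ij}$ and $M_{iB}$ for a plan with \<open>n\<close> runs: \<open>x\<close>, \<open>y\<close> are rows of the array,
  and the row and column indices of the matrix are symbols occurring in them.
\<close>

definition count_matrix :: "nat \<Rightarrow> (nat \<Rightarrow> 'p) \<Rightarrow> (nat \<Rightarrow> 'q) \<Rightarrow> 'p \<Rightarrow> 'q \<Rightarrow> nat" where
  "count_matrix n x y p q = card {c \<in> {1..n}. x c = p \<and> y c = q}"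

definition orthogonal_through_block ::
  "nat \<Rightarrow> nat \<Rightarrow> (nat \<Rightarrow> 'a set) \<Rightarrow> (nat \<Rightarrow> nat) \<Rightarrow> (nat \<Rightarrow> nat \<Rightarrow> 'a) \<Rightarrow> nat \<Rightarrow> nat \<Rightarrow> bool" where
  "orthogonal_through_block b k S B F i j \<longleftrightarrow>
     (\<forall>p\<in>S i. \<forall>q\<in>S j.
        (\<Sum>h\<in>{1..b}. count_matrix (b * k) (F i) B p h * count_matrix (b * k) (F j) B q h)
          = k * count_matrix (b * k) (F i) (F j) p q)"

definition potb ::
  "nat \<Rightarrow> nat \<Rightarrow> nat \<Rightarrow> (nat \<Rightarrow> 'a set) \<Rightarrow> (nat \<Rightarrow> nat) \<Rightarrow> (nat \<Rightarrow> nat \<Rightarrow> 'a) \<Rightarrow> bool" where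
  "potb b k t S B F \<longleftrightarrow>
     blocked_mep b k t S B F \<and>
     (\<forall>i\<in>{1..t}. \<forall>j\<in>{1..t}. i \<noteq> j \<longrightarrow> orthogonal_through_block b k S B F i j)"

definition connected_design :: "'a set \<Rightarrow> nat \<Rightarrow> ('a \<Rightarrow> nat \<Rightarrow> nat) \<Rightarrow> bool" where
  "connected_design V b N \<longleftrightarrow>
     (\<forall>p\<in>V. \<forall>q\<in>V.
        (p, q) \<in> {(x, y). x \<in> V \<and> y \<in> V \<and> x \<noteq> y \<and> (\<exists>j\<in>{1..b}. N x j > 0 \<and> N y j > 0)}\<^sup>*)"

text \<open>
  The blocks are the columns of \<open>N\<close>, so repeated blocks are allowed.
  ``Incomplete'' is read strictly: the block size is less than the number of treatments.
\<close>

definition bibd_incidence :: "'a set \<Rightarrow> nat \<Rightarrow> nat \<Rightarrow> ('a \<Rightarrow> nat \<Rightarrow> nat) \<Rightarrow> bool" where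
  "bibd_incidence V b k N \<longleftrightarrow>
     finite V \<and> 2 \<le> k \<and> k < card V \<and>
     (\<forall>p\<in>V. \<forall>j\<in>{1..b}. N p j \<in> {0, 1}) \<and>
     (\<forall>j\<in>{1..b}. (\<Sum>p\<in>V. N p j) = k) \<and>
     (\<exists>r. \<forall>p\<in>V. (\<Sum>j\<in>{1..b}. N p j) = r) \<and>
     (\<exists>l. \<forall>p\<in>V. \<forall>q\<in>V. p \<noteq> q \<longrightarrow> (\<Sum>j\<in>{1..b}. N p j * N q j) = l)"

definition connected_plan ::
  "nat \<Rightarrow> nat \<Rightarrow> nat \<Rightarrow> (nat \<Rightarrow> 'a set) \<Rightarrow> (nat \<Rightarrow> nat) \<Rightarrow> (nat \<Rightarrow> nat \<Rightarrow> 'a) \<Rightarrow> bool" where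
  "connected_plan b k t S B F \<longleftrightarrow>
     (\<forall>i\<in>{1..t}. connected_design (S i) b (count_matrix (b * k) (F i) B))"

definition balanced_potb ::
  "nat \<Rightarrow> nat \<Rightarrow> nat \<Rightarrow> (nat \<Rightarrow> 'a set) \<Rightarrow> (nat \<Rightarrow> nat) \<Rightarrow> (nat \<Rightarrow> nat \<Rightarrow> 'a) \<Rightarrow> bool" where
  "balanced_potb b k t S B F \<longleftrightarrow>
     potb b k t S B F \<and> connected_plan b k t S B F \<and>
     (\<forall>i\<in>{1..t}. bibd_incidence (S i) b k (count_matrix (b * k) (F i) B))"

end

theory Submission
  imports Defs
begin

text \<open>
  Write \<open>N\<^sub>i\<close> for the incidence matrix of factor \<open>F\<^sub>i\<close> against the blocks of the given plan, and
  identify the \<open>k\<close> plots of every block with the symbols of the orthogonal array \<open>A\<close>, so that a plot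
  of the given plan is a pair \<open>(j, u)\<close> of a block and a symbol. The plots of the new plan are the
  pairs \<open>(j, c)\<close> of an old block and a column of \<open>A\<close>. The first row of \<open>A\<close> cuts each old block into
  \<open>k\<close> new ones: \<open>(j, c)\<close> lies in the new block \<open>(j, A\<^sub>1 c)\<close>. Each further row \<open>l\<close> of \<open>A\<close> yields a copy
  of every old factor: the factor \<open>(i, l)\<close> takes on \<open>(j, c)\<close> the level of \<open>F\<^sub>i\<close> on the old plot
  \<open>(j, A\<^sub>l c)\<close>.

  Comparing \<open>k\<^sup>2\<close> columns with \<open>k\<^sup>2\<close> pairs of symbols, every pair occurs exactly once in any two rows
  of \<open>A\<close> (\<open>orthogonal_array2_bij\<close>). Three consequences carry the proof.

  Rows \<open>1\<close> and \<open>l\<close>: inside the new block \<open>(j, z)\<close> the symbol \<open>A\<^sub>l c\<close> runs once through all symbols.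
  Hence the design of \<open>(i, l)\<close> is that of \<open>F\<^sub>i\<close> with every block repeated \<open>k\<close> times. Repetition
  preserves connectedness and balance, and it multiplies the \<open>(p, q)\<close> entry of \<open>N\<^sub>i N\<^sub>i\<^sub>'\<^sup>T\<close>, that is
  \<open>\<Sum>\<^sub>j N\<^sub>i(p, j) N\<^sub>i\<^sub>'(q, j)\<close>, by \<open>k\<close>.

  Rows \<open>l \<noteq> l'\<close>: in each old block all pairs of plots occur once, so the levels \<open>p\<close> of \<open>(i, l)\<close> and
  \<open>q\<close> of \<open>(i', l')\<close> meet \<open>\<Sum>\<^sub>j N\<^sub>i(p, j) N\<^sub>i\<^sub>'(q, j)\<close> times, even if \<open>i = i'\<close>. This is orthogonality
  through the new blocks.

  The same row twice, with \<open>i \<noteq> i'\<close>: every old plot is used \<open>k\<close> times, so \<open>p\<close> and \<open>q\<close> meet \<open>k\<close> times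
  as often as before, which by the orthogonality of the given plan is again
  \<open>\<Sum>\<^sub>j N\<^sub>i(p, j) N\<^sub>i\<^sub>'(q, j)\<close>.
\<close>

lemma card_Collect_bij_betw:
  assumes "bij_betw h X Y"
  shows "card {x \<in> X. P (h x)} = card {y \<in> Y. P y}"
proof -
  have "bij_betw h {x \<in> X. P (h x)} {y \<in> Y. P y}"
    using assms unfolding bij_betw_def inj_on_def by auto
  then show ?thesis
    by (rule bij_betw_same_card)
qed

lemma card_Collect_Times:
  assumes "finite X" "finite Y"
  shows "card {w \<in> X \<times> Y. P (fst w) (snd w)} = (\<Sum>x\<in>X. card {y \<in> Y. P x y})"
proof -
  have "{w \<in> X \<times> Y. P (fst w) (snd w)} = Sigma X (\<lambda>x. {y \<in> Y. P x y})"
    by auto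
  then show ?thesis
    using assms by simp
qed

text \<open>
  The common number of occurrences is not zero, since a first column exists; so every pair of
  symbols occurs, and there are just as many pairs as columns.
\<close>

lemma orthogonal_array2_bij:
  assumes oa: "orthogonal_array2 (k ^ 2) r k \<Sigma> A" and k: "k \<ge> 1"
    and s: "s \<in> {1..r}" and t: "t \<in> {1..r}" and st: "s \<noteq> t"
  shows "bij_betw (\<lambda>c. (A s c, A t c)) {1..k ^ 2} (\<Sigma> \<times> \<Sigma>)"
proof -
  let ?h = "\<lambda>c. (A s c, A t c)"
  have fin: "finite \<Sigma>" and cS: "card \<Sigma> = k"
    and into: "?h ` {1..k ^ 2} \<subseteq> \<Sigma> \<times> \<Sigma>"
    using oa s t unfolding orthogonal_array2_def by auto
  obtain l where l: "\<And>x y. x \<in> \<Sigma> \<Longrightarrow> y \<in> \<Sigma> \<Longrightarrow> card {c \<in> {1..k ^ 2}. A s c = x \<and> A t c = y} = l"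
    using oa s t st unfolding orthogonal_array2_def by blast
  have cT: "card (\<Sigma> \<times> \<Sigma>) = k ^ 2"
    by (simp add: card_cartesian_product cS power2_eq_square)
  have "l \<noteq> 0"
  proof
    assume l0: "l = 0"
    obtain c where c: "c \<in> {1..k ^ 2}"
      using k by fastforce
    then have "A s c \<in> \<Sigma>" "A t c \<in> \<Sigma>"
      using into by (auto simp: image_subset_iff)
    then have "{c' \<in> {1..k ^ 2}. A s c' = A s c \<and> A t c' = A t c} = {}"
      using l[of "A s c" "A t c"] l0 by simp
    then show False
      using c by blast
  qed
  have "\<Sigma> \<times> \<Sigma> \<subseteq> ?h ` {1..k ^ 2}"
  proof clarify
    fix x y assume "x \<in> \<Sigma>" "y \<in> \<Sigma>"
    then have "{c \<in> {1..k ^ 2}. A s c = x \<and> A t c = y} \<noteq> {}"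
      using l[of x y] \<open>l \<noteq> 0\<close> by (metis card.empty)
    then show "(x, y) \<in> ?h ` {1..k ^ 2}"
      by auto
  qed
  with into have img: "?h ` {1..k ^ 2} = \<Sigma> \<times> \<Sigma>"
    by blast
  moreover have "inj_on ?h {1..k ^ 2}"
    using img cT by (intro eq_card_imp_inj_on) simp_all
  ultimately show ?thesis
    by (simp add: bij_betw_def)
qed

text \<open>
  In the next three lemmas \<open>blk\<close> numbers \<open>card Z\<close> copies of each of the blocks \<open>1, \<dots>, b\<close>; the first
  component of \<open>blk h\<close> is the block of which \<open>h\<close> is a copy.
\<close>

lemma sum_replicated_blocks:
  fixes G :: "nat \<Rightarrow> nat"
  assumes "bij_betw blk {1..b'} ({1..b} \<times> Z)"
  shows "(\<Sum>h\<in>{1..b'}. G (fst (blk h))) = card Z * (\<Sum>j\<in>{1..b}. G j)"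
proof -
  have "(\<Sum>h\<in>{1..b'}. G (fst (blk h))) = (\<Sum>w\<in>{1..b} \<times> Z. G (fst w))"
    using sum.reindex_bij_betw[OF assms, of "\<lambda>w. G (fst w)"] by simp
  also have "\<dots> = (\<Sum>j\<in>{1..b}. \<Sum>z\<in>Z. G j)"
    by (simp only: sum.cartesian_product case_prod_unfold)
  also have "\<dots> = card Z * (\<Sum>j\<in>{1..b}. G j)"
    by (simp add: sum_distrib_left)
  finally show ?thesis .
qed

lemma bibd_incidence_replicated_blocks:
  assumes blk: "bij_betw blk {1..b'} ({1..b} \<times> Z)"
    and N': "\<And>p h. h \<in> {1..b'} \<Longrightarrow> N' p h = N p (fst (blk h))"
    and N: "bibd_incidence V b k N"
  shows "bibd_incidence V b' k N'"
proof -
  have old: "fst (blk h) \<in> {1..b}" if "h \<in> {1..b'}" for h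
    using blk that bij_betwE by fastforce
  obtain r l where r: "\<forall>p\<in>V. (\<Sum>j\<in>{1..b}. N p j) = r"
    and l: "\<forall>p\<in>V. \<forall>q\<in>V. p \<noteq> q \<longrightarrow> (\<Sum>j\<in>{1..b}. N p j * N q j) = l"
    using N unfolding bibd_incidence_def by blast
  have "(\<Sum>h\<in>{1..b'}. N' p h) = card Z * (\<Sum>j\<in>{1..b}. N p j)" for p
    using sum_replicated_blocks[OF blk, of "N p"] N' by simp
  then have r': "\<forall>p\<in>V. (\<Sum>h\<in>{1..b'}. N' p h) = card Z * r"
    using r by simp
  have "(\<Sum>h\<in>{1..b'}. N' p h * N' q h) = card Z * (\<Sum>j\<in>{1..b}. N p j * N q j)" for p q
    using sum_replicated_blocks[OF blk, of "\<lambda>j. N p j * N q j"] N' by simp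
  then have l': "\<forall>p\<in>V. \<forall>q\<in>V. p \<noteq> q \<longrightarrow> (\<Sum>h\<in>{1..b'}. N' p h * N' q h) = card Z * l"
    using l by simp
  have "\<forall>p\<in>V. \<forall>h\<in>{1..b'}. N' p h \<in> {0, 1}" and "\<forall>h\<in>{1..b'}. (\<Sum>p\<in>V. N' p h) = k"
    using N old N' unfolding bibd_incidence_def by simp_all
  then show ?thesis
    using N r' l' unfolding bibd_incidence_def by blast
qed

lemma connected_design_replicated_blocks:
  assumes blk: "bij_betw blk {1..b'} ({1..b} \<times> Z)" and Z: "Z \<noteq> {}"
    and N': "\<And>p h. h \<in> {1..b'} \<Longrightarrow> N' p h = N p (fst (blk h))"
    and N: "connected_design V b N"
  shows "connected_design V b' N'"
proof -
  have img: "{1..b} = (\<lambda>h. fst (blk h)) ` {1..b'}"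
    using blk Z by (simp add: bij_betw_imp_surj_on flip: image_image)
  have "(\<exists>j\<in>{1..b}. N x j > 0 \<and> N y j > 0) \<longleftrightarrow> (\<exists>h\<in>{1..b'}. N' x h > 0 \<and> N' y h > 0)" for x y
    unfolding img by (simp add: N')
  then show ?thesis
    using N unfolding connected_design_def by simp
qed

theorem theorem3p6:
  fixes b k f m :: nat
  assumes "\<exists>(S :: nat \<Rightarrow> 'a set) B F. balanced_potb b k f S B F"
    and "f \<le> k"
    and "m \<ge> 1"
    and "\<exists>(\<Sigma> :: 'c set) A. orthogonal_array2 (k ^ 2) (m + 1) k \<Sigma> A"
  shows "\<exists>(S :: nat \<Rightarrow> 'a set) B F. balanced_potb (b * k) k (m * f) S B F"
proof -
  obtain S :: "nat \<Rightarrow> 'a set" and B F where plan: "balanced_potb b k f S B F"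
    using assms(1) by blast
  obtain \<Sigma> :: "'c set" and A where oa: "orthogonal_array2 (k ^ 2) (m + 1) k \<Sigma> A"
    using assms(4) by blast
  have mep: "blocked_mep b k f S B F"
    and orth: "\<And>i j. i \<in> {1..f} \<Longrightarrow> j \<in> {1..f} \<Longrightarrow> i \<noteq> j \<Longrightarrow> orthogonal_through_block b k S B F i j"
    and conn: "\<And>i. i \<in> {1..f} \<Longrightarrow> connected_design (S i) b (count_matrix (b * k) (F i) B)"
    and bibd: "\<And>i. i \<in> {1..f} \<Longrightarrow> bibd_incidence (S i) b k (count_matrix (b * k) (F i) B)"
    using plan unfolding balanced_potb_def potb_def connected_plan_def by blast+
  have b1: "b \<ge> 1" and k1: "k \<ge> 1" and f1: "f \<ge> 1"
    and Bran: "\<And>c. c \<in> {1..b * k} \<Longrightarrow> B c \<in> {1..b}"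
    and Bcard: "\<And>j. j \<in> {1..b} \<Longrightarrow> card {c \<in> {1..b * k}. B c = j} = k"
    and Sfin: "\<And>i. i \<in> {1..f} \<Longrightarrow> finite (S i)"
    and Fran: "\<And>i c. i \<in> {1..f} \<Longrightarrow> c \<in> {1..b * k} \<Longrightarrow> F i c \<in> S i"
    using mep unfolding blocked_mep_def by blast+
  have finS: "finite \<Sigma>" and cardS: "card \<Sigma> = k"
    and Aran: "\<And>r c. r \<in> {1..m + 1} \<Longrightarrow> c \<in> {1..k ^ 2} \<Longrightarrow> A r c \<in> \<Sigma>"
    using oa unfolding orthogonal_array2_def by blast+
  have S_ne: "\<Sigma> \<noteq> {}"
    using cardS k1 by auto
  note row_pair = orthogonal_array2_bij[OF oa k1]

  \<comment> \<open>\<open>e j u\<close> is the plot \<open>u\<close> of the old block \<open>j\<close>.\<close>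
  have "\<exists>e. bij_betw e \<Sigma> {c \<in> {1..b * k}. B c = j}" if "j \<in> {1..b}" for j
    using that finS cardS Bcard by (intro finite_same_card_bij) auto
  then obtain e where e: "\<And>j. j \<in> {1..b} \<Longrightarrow> bij_betw (e j) \<Sigma> {c \<in> {1..b * k}. B c = j}"
    by metis
  have e_run: "e j u \<in> {1..b * k}" if "j \<in> {1..b}" "u \<in> \<Sigma>" for j u
    using bij_betwE[OF e] that by blast

  \<comment> \<open>A plan indexes its runs, blocks and factors by initial segments of the positive integers,
    so the pairs that play these roles have to be numbered. Row 1 is spent on the blocks,
    hence factors use the rows from 2 on.\<close>
  obtain run where run: "bij_betw run {1..b * k * k} ({1..b} \<times> {1..k ^ 2})"
    using finite_same_card_bij[of "{1..b * k * k}" "{1..b} \<times> {1..k ^ 2}"]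
    by (auto simp: power2_eq_square)
  obtain blk where blk: "bij_betw blk {1..b * k} ({1..b} \<times> \<Sigma>)"
    using finite_same_card_bij[of "{1..b * k}" "{1..b} \<times> \<Sigma>"] finS cardS
    by auto
  obtain fac where fac: "bij_betw fac {1..m * f} ({2..m + 1} \<times> {1..f})"
    using finite_same_card_bij[of "{1..m * f}" "{2..m + 1} \<times> {1..f}"]
    by auto
  define S' where "S' g = S (snd (fac g))" for g
  define B' where "B' d = inv_into {1..b * k} blk (fst (run d), A 1 (snd (run d)))" for d
  define F' where "F' g d = F (snd (fac g)) (e (fst (run d)) (A (fst (fac g)) (snd (run d))))" for g d

  have run_in: "fst (run d) \<in> {1..b}" "snd (run d) \<in> {1..k ^ 2}" if "d \<in> {1..b * k * k}" for d
    using bij_betwE[OF run] that by (auto simp: mem_Times_iff)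
  have blk_in: "fst (blk h) \<in> {1..b}" "snd (blk h) \<in> \<Sigma>" if "h \<in> {1..b * k}" for h
    using bij_betwE[OF blk] that by (auto simp: mem_Times_iff)
  have fac_in: "fst (fac g) \<in> {1..m + 1}" "fst (fac g) \<noteq> 1" "snd (fac g) \<in> {1..f}"
    if "g \<in> {1..m * f}" for g
    using bij_betwE[OF fac] that by (fastforce simp: mem_Times_iff)+

  have pair_in: "(fst (run d), A 1 (snd (run d))) \<in> {1..b} \<times> \<Sigma>" if "d \<in> {1..b * k * k}" for d
    using run_in[OF that] Aran by auto
  have B'_iff: "B' d = h \<longleftrightarrow> (fst (run d), A 1 (snd (run d))) = blk h"
    if "d \<in> {1..b * k * k}" "h \<in> {1..b * k}" for d h
    using pair_in[OF that(1)] that(2) blk unfolding B'_def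
    by (metis bij_betw_inv_into_left bij_betw_inv_into_right)
  have B'_in: "B' d \<in> {1..b * k}" if "d \<in> {1..b * k * k}" for d
    using pair_in[OF that] blk unfolding B'_def
    by (metis bij_betw_imp_surj_on inv_into_into)

  have count_runs: "card {d \<in> {1..b * k * k}. P (fst (run d)) (snd (run d))}
      = (\<Sum>j\<in>{1..b}. card {c \<in> {1..k ^ 2}. P j c})" for P
    using card_Collect_bij_betw[OF run, of "\<lambda>w. P (fst w) (snd w)"]
      card_Collect_Times[of "{1..b}" "{1..k ^ 2}" P] by simp

  \<comment> \<open>Within a new block every row of the array other than the first meets each symbol once.\<close>
  have count_block: "card {d \<in> {1..b * k * k}. P (fst (run d)) (A r (snd (run d))) \<and> B' d = h}
      = card {u \<in> \<Sigma>. P (fst (blk h)) u}"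
    if r: "r \<in> {1..m + 1}" "r \<noteq> 1" and h: "h \<in> {1..b * k}" for P r h
  proof -
    obtain j z where jz: "blk h = (j, z)"
      by fastforce
    then have j: "j \<in> {1..b}" and z: "z \<in> \<Sigma>"
      using blk_in[OF h] by auto
    have "{d \<in> {1..b * k * k}. P (fst (run d)) (A r (snd (run d))) \<and> B' d = h}
        = {d \<in> {1..b * k * k}. P (fst (run d)) (A r (snd (run d)))
            \<and> fst (run d) = j \<and> A 1 (snd (run d)) = z}"
      using B'_iff[OF _ h] jz by auto
    then have "card {d \<in> {1..b * k * k}. P (fst (run d)) (A r (snd (run d))) \<and> B' d = h}
        = (\<Sum>i\<in>{1..b}. card {c \<in> {1..k ^ 2}. P i (A r c) \<and> i = j \<and> A 1 c = z})"
      using count_runs[of "\<lambda>i c. P i (A r c) \<and> i = j \<and> A 1 c = z"] by simp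
    also have "\<dots> = (\<Sum>i\<in>{1..b}. if i = j then card {c \<in> {1..k ^ 2}. P j (A r c) \<and> A 1 c = z} else 0)"
      by (rule sum.cong) auto
    also have "\<dots> = card {c \<in> {1..k ^ 2}. P j (A r c) \<and> A 1 c = z}"
      using j by simp
    also have "\<dots> = card {w \<in> \<Sigma> \<times> \<Sigma>. P j (fst w) \<and> snd w = z}"
      using card_Collect_bij_betw[OF row_pair[of r 1], of "\<lambda>w. P j (fst w) \<and> snd w = z"] r by simp
    also have "{w \<in> \<Sigma> \<times> \<Sigma>. P j (fst w) \<and> snd w = z} = {u \<in> \<Sigma>. P j u} \<times> {z}"
      using z by auto
    also have "card \<dots> = card {u \<in> \<Sigma>. P j u}"
      by (simp add: card_cartesian_product)
    finally show ?thesis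
      using jz by simp
  qed

  have count_plots: "card {c \<in> {1..b * k}. Q c \<and> B c = j} = card {u \<in> \<Sigma>. Q (e j u)}"
    if "j \<in> {1..b}" for Q j
  proof -
    have "card {u \<in> \<Sigma>. Q (e j u)} = card {c \<in> {c \<in> {1..b * k}. B c = j}. Q c}"
      by (rule card_Collect_bij_betw[OF e[OF that]])
    also have "{c \<in> {c \<in> {1..b * k}. B c = j}. Q c} = {c \<in> {1..b * k}. Q c \<and> B c = j}"
      by auto
    finally show ?thesis by simp
  qed
  have count_all_plots: "card {c \<in> {1..b * k}. Q c} = (\<Sum>j\<in>{1..b}. card {u \<in> \<Sigma>. Q (e j u)})" for Q
  proof -
    have "card {c \<in> {1..b * k}. Q c} = card (\<Union>j\<in>{1..b}. {c \<in> {1..b * k}. Q c \<and> B c = j})"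
      using Bran by (intro arg_cong[where f = card]) auto
    also have "\<dots> = (\<Sum>j\<in>{1..b}. card {c \<in> {1..b * k}. Q c \<and> B c = j})"
      by (intro card_UN_disjoint) auto
    finally show ?thesis
      using count_plots by simp
  qed

  have incidence: "count_matrix (b * k * k) (F' g) B' p h
      = count_matrix (b * k) (F (snd (fac g))) B p (fst (blk h))"
    if g: "g \<in> {1..m * f}" and h: "h \<in> {1..b * k}" for g p h
    using count_block[OF fac_in(1,2)[OF g] h, of "\<lambda>j u. F (snd (fac g)) (e j u) = p"]
      count_plots[OF blk_in(1)[OF h], of "\<lambda>c. F (snd (fac g)) c = p"]
    unfolding count_matrix_def F'_def by simp

  have "blocked_mep (b * k) k (m * f) S' B' F'"
    unfolding blocked_mep_def
  proof (intro conjI ballI)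
    fix h assume h: "h \<in> {1..b * k}"
    \<comment> \<open>Row 2 exists because \<open>m \<ge> 1\<close>.\<close>
    show "card {d \<in> {1..b * k * k}. B' d = h} = k"
      using count_block[of 2 h "\<lambda>_ _. True"] h assms(3) cardS by simp
  next
    fix g d assume "g \<in> {1..m * f}" "d \<in> {1..b * k * k}"
    then show "F' g d \<in> S' g"
      unfolding F'_def S'_def using fac_in run_in Aran e_run Fran by blast
  next
    fix g assume "g \<in> {1..m * f}"
    then show "finite (S' g)"
      unfolding S'_def using fac_in Sfin by blast
  qed (use b1 k1 f1 assms(3) B'_in in auto)

  moreover have "orthogonal_through_block (b * k) k S' B' F' g g'"
    if g: "g \<in> {1..m * f}" and g': "g' \<in> {1..m * f}" and ne: "g \<noteq> g'" for g g'
    unfolding orthogonal_through_block_def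
  proof (intro ballI)
    fix p q assume p: "p \<in> S' g" and q: "q \<in> S' g'"
    obtain r i where ri: "fac g = (r, i)" by fastforce
    obtain r' i' where ri': "fac g' = (r', i')" by fastforce
    have r: "r \<in> {1..m + 1}" "r \<noteq> 1" and i: "i \<in> {1..f}"
      and r': "r' \<in> {1..m + 1}" and i': "i' \<in> {1..f}"
      using fac_in[OF g] fac_in[OF g'] ri ri' by auto
    have ri_ne: "(r, i) \<noteq> (r', i')"
      using ne g g' fac ri ri' by (metis bij_betw_imp_inj_on inj_onD)
    let ?N = "\<lambda>i p j. count_matrix (b * k) (F i) B p j"
    have N: "?N i p j = card {u \<in> \<Sigma>. F i (e j u) = p}" if "j \<in> {1..b}" for i p j
      unfolding count_matrix_def using count_plots[OF that, of "\<lambda>c. F i c = p"] by simp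
    have M: "count_matrix (b * k * k) (F' g) (F' g') p q
        = (\<Sum>j\<in>{1..b}. card {c \<in> {1..k ^ 2}. F i (e j (A r c)) = p \<and> F i' (e j (A r' c)) = q})"
      unfolding count_matrix_def F'_def ri ri'
      using count_runs[of "\<lambda>j c. F i (e j (A r c)) = p \<and> F i' (e j (A r' c)) = q"] by simp
    have meet: "count_matrix (b * k * k) (F' g) (F' g') p q = (\<Sum>j\<in>{1..b}. ?N i p j * ?N i' q j)"
    proof (cases "r = r'")
      case False
      have "card {c \<in> {1..k ^ 2}. F i (e j (A r c)) = p \<and> F i' (e j (A r' c)) = q}
          = ?N i p j * ?N i' q j" if j: "j \<in> {1..b}" for j
      proof -
        have "card {c \<in> {1..k ^ 2}. F i (e j (A r c)) = p \<and> F i' (e j (A r' c)) = q}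
            = card {w \<in> \<Sigma> \<times> \<Sigma>. F i (e j (fst w)) = p \<and> F i' (e j (snd w)) = q}"
          using card_Collect_bij_betw[OF row_pair[OF r(1) r' False],
              of "\<lambda>w. F i (e j (fst w)) = p \<and> F i' (e j (snd w)) = q"] by simp
        also have "{w \<in> \<Sigma> \<times> \<Sigma>. F i (e j (fst w)) = p \<and> F i' (e j (snd w)) = q}
            = {u \<in> \<Sigma>. F i (e j u) = p} \<times> {u \<in> \<Sigma>. F i' (e j u) = q}"
          by auto
        finally show ?thesis
          by (simp only: card_cartesian_product N[OF j])
      qed
      then show ?thesis
        unfolding M by simp
    next
      case True
      with ri_ne have "i \<noteq> i'" by simp
      \<comment> \<open>Pairing row \<open>r\<close> with row 1 shows that each symbol occurs \<open>k\<close> times in row \<open>r\<close>.\<close>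
      have "card {c \<in> {1..k ^ 2}. F i (e j (A r c)) = p \<and> F i' (e j (A r' c)) = q}
          = k * card {u \<in> \<Sigma>. F i (e j u) = p \<and> F i' (e j u) = q}" for j
      proof -
        have "card {c \<in> {1..k ^ 2}. F i (e j (A r c)) = p \<and> F i' (e j (A r' c)) = q}
            = card {w \<in> \<Sigma> \<times> \<Sigma>. F i (e j (fst w)) = p \<and> F i' (e j (fst w)) = q}"
          using card_Collect_bij_betw[OF row_pair[of r 1],
              of "\<lambda>w. F i (e j (fst w)) = p \<and> F i' (e j (fst w)) = q"] r True by simp
        also have "{w \<in> \<Sigma> \<times> \<Sigma>. F i (e j (fst w)) = p \<and> F i' (e j (fst w)) = q}
            = {u \<in> \<Sigma>. F i (e j u) = p \<and> F i' (e j u) = q} \<times> \<Sigma>"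
          by auto
        finally show ?thesis
          by (simp add: card_cartesian_product cardS)
      qed
      then have "count_matrix (b * k * k) (F' g) (F' g') p q
          = k * (\<Sum>j\<in>{1..b}. card {u \<in> \<Sigma>. F i (e j u) = p \<and> F i' (e j u) = q})"
        unfolding M by (simp add: sum_distrib_left)
      also have "\<dots> = k * count_matrix (b * k) (F i) (F i') p q"
        unfolding count_matrix_def
        using count_all_plots[of "\<lambda>c. F i c = p \<and> F i' c = q"] by simp
      also have "\<dots> = (\<Sum>j\<in>{1..b}. ?N i p j * ?N i' q j)"
        using orth[OF i i' \<open>i \<noteq> i'\<close>] p q
        unfolding orthogonal_through_block_def S'_def ri ri' by simp
      finally show ?thesis .
    qed
    have "(\<Sum>h\<in>{1..b * k}. count_matrix (b * k * k) (F' g) B' p h * count_matrix (b * k * k) (F' g') B' q h)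
        = (\<Sum>h\<in>{1..b * k}. ?N i p (fst (blk h)) * ?N i' q (fst (blk h)))"
      using incidence[OF g] incidence[OF g'] ri ri' by simp
    also have "\<dots> = k * (\<Sum>j\<in>{1..b}. ?N i p j * ?N i' q j)"
      using sum_replicated_blocks[OF blk, of "\<lambda>j. ?N i p j * ?N i' q j"] cardS by simp
    finally show "(\<Sum>h\<in>{1..b * k}. count_matrix (b * k * k) (F' g) B' p h * count_matrix (b * k * k) (F' g') B' q h)
        = k * count_matrix (b * k * k) (F' g) (F' g') p q"
      unfolding meet .
  qed

  moreover have "connected_design (S' g) (b * k) (count_matrix (b * k * k) (F' g) B')"
    if g: "g \<in> {1..m * f}" for g
    unfolding S'_def
    using connected_design_replicated_blocks[OF blk S_ne incidence[OF g] conn[OF fac_in(3)[OF g]]] .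

  moreover have "bibd_incidence (S' g) (b * k) k (count_matrix (b * k * k) (F' g) B')"
    if g: "g \<in> {1..m * f}" for g
    unfolding S'_def
    using bibd_incidence_replicated_blocks[OF blk incidence[OF g] bibd[OF fac_in(3)[OF g]]] .

  ultimately have "balanced_potb (b * k) k (m * f) S' B' F'"
    unfolding balanced_potb_def potb_def connected_plan_def by blast
  then show ?thesis
    by blast
qed

end
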